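(* Let $m, q \geq 1$ be integers and consider the Box Game with resets $rBox(m,q)$. For every integer $k \geq 1$, BoxBreaker has a strategy which ensures that, at any point during the first $k$ rounds of the game, every box has weight at most $q(1 + \log(m+k))$.
   Context: The Box Game with resets $rBox(m,q)$ is played by BoxMaker and BoxBreaker on pairwise disjoint sets (boxes) $A_1, \ldots, A_m$. In each round, BoxMaker claims $q$ elements of $\bigcup_{i=1}^m A_i$, and then BoxBreaker resets one box $A_i$ of his choice, i.e., deletes all of BoxMaker's elements from $A_i$ (the box stays in the game and BoxMaker may claim its elements again). At any moment, the weight of box $A_i$ is the number of elements of $A_i$ claimed by BoxMaker and not yet deleted by BoxBreaker. $\log$ denotes the natural logarithm. *)

theory Defs
  imports Complex_Main "HOL-Library.Disjoint_Sets"
begin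

text \<open>
  The Box Game with resets on boxes \<open>A 1, \<dots>, A m\<close>.  A position is represented by the set
  \<open>C\<close> of elements claimed by BoxMaker and not yet deleted by BoxBreaker.  The boxes are arbitrary
  sets, finite or infinite.
\<close>

definition free_elements :: "(nat \<Rightarrow> 'a set) \<Rightarrow> nat \<Rightarrow> 'a set \<Rightarrow> 'a set" where
  "free_elements A m C = (\<Union>i\<in>{1..m}. A i) - C"

definition weight :: "(nat \<Rightarrow> 'a set) \<Rightarrow> 'a set \<Rightarrow> nat \<Rightarrow> nat" where
  "weight A C i = card (A i \<inter> C)"

definition maker_move :: "(nat \<Rightarrow> 'a set) \<Rightarrow> nat \<Rightarrow> nat \<Rightarrow> 'a set \<Rightarrow> 'a set \<Rightarrow> bool" where
  "maker_move A m q C X \<longleftrightarrow> X \<subseteq> free_elements A m C \<and> finite X \<and> card X = q"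

definition reset :: "(nat \<Rightarrow> 'a set) \<Rightarrow> nat \<Rightarrow> 'a set \<Rightarrow> 'a set" where
  "reset A i C = C - A i"

text \<open>
  A strategy of BoxBreaker maps the list of all moves made so far by BoxMaker, in chronological
  order and including the one of the current round, to the index of the box to reset.
  BoxBreaker's own earlier moves are determined by this list and the strategy.
\<close>

type_synonym 'a strategy = "'a set list \<Rightarrow> nat"

definition breaker_strategy :: "nat \<Rightarrow> 'a strategy \<Rightarrow> bool" where
  "breaker_strategy m \<sigma> \<longleftrightarrow> (\<forall>h. \<sigma> h \<in> {1..m})"

text \<open>
  \<open>play A m q \<sigma> h C\<close>: in a game where BoxBreaker follows \<open>\<sigma>\<close>, after \<open>length h\<close> complete rounds
  in which BoxMaker made the legal moves \<open>h\<close>, the position is \<open>C\<close>.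
\<close>

inductive play ::
  "(nat \<Rightarrow> 'a set) \<Rightarrow> nat \<Rightarrow> nat \<Rightarrow> 'a strategy \<Rightarrow> 'a set list \<Rightarrow> 'a set \<Rightarrow> bool"
  for A :: "nat \<Rightarrow> 'a set" and m q :: nat and \<sigma> :: "'a strategy"
where
  start: "play A m q \<sigma> [] {}"
| round: "play A m q \<sigma> h C \<Longrightarrow> maker_move A m q C X \<Longrightarrow>
          play A m q \<sigma> (h @ [X]) (reset A (\<sigma> (h @ [X])) (C \<union> X))"

text \<open>
  The positions occurring at any point during the first \<open>k\<close> rounds: those between rounds, and those
  within a round, where BoxMaker has claimed some set \<open>P\<close> of at most \<open>q\<close> of the elements of his
  current move (all of them if \<open>card P = q\<close>) and BoxBreaker has not yet answered.
\<close>

inductive position_within ::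
  "(nat \<Rightarrow> 'a set) \<Rightarrow> nat \<Rightarrow> nat \<Rightarrow> 'a strategy \<Rightarrow> nat \<Rightarrow> 'a set \<Rightarrow> bool"
  for A :: "nat \<Rightarrow> 'a set" and m q :: nat and \<sigma> :: "'a strategy" and k :: nat
where
  between_rounds: "play A m q \<sigma> h C \<Longrightarrow> length h \<le> k \<Longrightarrow> position_within A m q \<sigma> k C"
| within_round: "play A m q \<sigma> h C \<Longrightarrow> length h < k \<Longrightarrow>
                 P \<subseteq> free_elements A m C \<Longrightarrow> finite P \<Longrightarrow> card P \<le> q \<Longrightarrow>
                 position_within A m q \<sigma> k (C \<union> P)"

end

theory Submission
  imports Defs "HOL-Analysis.Harmonic_Numbers"
begin

text \<open>
  BoxBreaker always resets a heaviest box.  Then after \<open>r\<close> rounds any \<open>s\<close> boxes have total weight at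
  most \<open>s q (H(s + r) - H(s))\<close>, with \<open>H\<close> the harmonic numbers, by induction on \<open>r\<close>: a round adds at most \<open>q\<close> to every such total.  If the
  reset box \<open>j\<close> lies outside the set \<open>S\<close>, then adjoining \<open>j\<close> does not lower the average weight, so
  the bound for \<open>s + 1\<close> boxes applies; if it lies inside, then resetting it removes at least the
  average weight of \<open>S\<close>.  For a single box this gives at most \<open>q H(k) \<le> q (1 + log k)\<close> at any
  point during the first \<open>k\<close> rounds, whatever the value of \<open>m\<close>.
\<close>

text \<open>Each of the \<open>r\<close> terms \<open>1/i\<close> with \<open>s < i <= s + r\<close>
  is at least \<open>1/(s + r)\<close>. If \<open>s + r = 0\<close>, both sides vanish, since
  division by zero gives 0.\<close>

lemma harm_add_diff_ge: "real r / real (s + r) \<le> harm (s + r) - harm s"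
proof (cases "s + r = 0")
  case False
  have "(\<Sum>i\<in>{s<..s+r}. inverse (real i)) \<ge> (\<Sum>i\<in>{s<..s+r}. inverse (real (s + r)))"
    by (intro sum_mono le_imp_inverse_le) auto
  moreover have "harm (s + r) - harm s = (\<Sum>i\<in>{s<..s+r}. inverse (real i))"
  proof -
    have "{1..s+r} = {1..s} \<union> {s<..s+r}" by auto
    moreover have "{1..s} \<inter> {s<..s+r} = {}" by auto
    ultimately show ?thesis unfolding harm_def by (metis (no_types, lifting) add_diff_cancel_left'
      finite_atLeastAtMost finite_greaterThanAtMost sum.union_disjoint)
  qed
  ultimately show ?thesis by (simp add: divide_inverse)
qed simp

text \<open>The sequence \<open>H(n) - ln n\<close> is decreasing from \<open>n = 1\<close> on,
  where it equals 1.\<close>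

lemma harm_Suc_le_one_plus_ln: "harm (Suc n) \<le> 1 + ln (real (Suc n))"
  using euler_mascheroni_sequence_decreasing[of 1 "Suc n"] by (simp add: harm_expand)

text \<open>\<open>bound\<close> is the induction hypothesis for \<open>insert j S\<close> plus the
  \<open>q\<close> new elements. Starting the harmonic sum at \<open>s + 1\<close> instead of
  \<open>s\<close> omits the term \<open>1/(s + 1)\<close>; multiplied by \<open>(s + 1) q\<close>,
  this term is exactly the added \<open>q\<close>.\<close>

lemma sum_le_after_reset_outside:
  fixes w :: "'i \<Rightarrow> real"
  assumes "finite S" "j \<notin> S" "\<forall>i\<in>S. w i \<le> w j"
    and bound: "(\<Sum>i\<in>insert j S. w i) \<le> real (Suc (card S)) * real q * (harm (Suc (card S) + r) - harm (Suc (card S))) + real q"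
  shows "(\<Sum>i\<in>S. w i) \<le> real (card S) * real q * (harm (card S + Suc r) - harm (card S))"
proof -
  define s where "s = real (card S)"
  define D where "D = harm (card S + Suc r) - (harm (card S) :: real)"
  have s: "s \<ge> 0" by (simp add: s_def)
  have "(\<Sum>i\<in>S. w i) \<le> s * w j"
    unfolding s_def using assms(3) by (intro sum_bounded_above) auto
  then have "(s + 1) * (\<Sum>i\<in>S. w i) \<le> s * (\<Sum>i\<in>insert j S. w i)"
    using assms(1,2) by (simp add: algebra_simps)
  also have "\<dots> \<le> s * ((s + 1) * real q * D)"
  proof -
    have "harm (Suc (card S) + r) - harm (Suc (card S)) = D - 1 / (s + 1)"
      by (simp add: D_def s_def harm_Suc[of "card S"] divide_inverse add.commute)
    with bound have "(\<Sum>i\<in>insert j S. w i) \<le> (s + 1) * real q * (D - 1 / (s + 1)) + real q"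
      by (simp add: s_def add.commute)
    also have "\<dots> = (s + 1) * real q * D" using s by (simp add: field_simps)
    finally show ?thesis using s by (rule mult_left_mono)
  qed
  finally have "(s + 1) * (\<Sum>i\<in>S. w i) \<le> (s + 1) * (s * real q * D)"
    by (simp add: mult_ac)
  with s show ?thesis by (simp add: s_def D_def)
qed

text \<open>Dropping a heaviest box leaves at most the fraction \<open>(s - 1)/s\<close> of the
  total. The factor on the right stays \<open>card S\<close>, because after the reset
  \<open>j\<close> still belongs to \<open>S\<close>, with weight 0.\<close>

lemma sum_le_after_reset_inside:
  fixes w :: "'i \<Rightarrow> real"
  assumes "finite S" "j \<in> S" "\<forall>i\<in>S. w i \<le> w j"
    and bound: "(\<Sum>i\<in>S. w i) \<le> real (card S) * real q * (harm (card S + r) - harm (card S)) + real q"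
  shows "(\<Sum>i\<in>S - {j}. w i) \<le> real (card S) * real q * (harm (card S + Suc r) - harm (card S))"
proof -
  define s where "s = real (card S)"
  define D where "D = harm (card S + r) - (harm (card S) :: real)"
  have "card S > 0" using assms(1,2) card_gt_0_iff by blast
  then have s: "s \<ge> 1" by (simp add: s_def)
  have "(\<Sum>i\<in>S. w i) \<le> s * w j"
    unfolding s_def using assms(3) by (intro sum_bounded_above) auto
  moreover have "(\<Sum>i\<in>S. w i) = w j + (\<Sum>i\<in>S - {j}. w i)"
    using assms(1,2) by (simp add: sum.remove)
  ultimately have "s * (\<Sum>i\<in>S - {j}. w i) \<le> (s - 1) * (\<Sum>i\<in>S. w i)"
    by (simp add: algebra_simps)
  also have "\<dots> \<le> (s - 1) * (s * real q * D + real q)"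
    using bound s by (intro mult_left_mono) (simp_all add: s_def D_def)
  also have "\<dots> = real q * ((s - 1) * (s * D + 1))" by (simp add: algebra_simps)
  \<comment> \<open>After cancelling \<open>s^2 D\<close> the claim reads
    \<open>s - 1 <= s D + s^2/(s + r + 1)\<close>. Since
    \<open>D >= r/(s + r) >= r/(s + r + 1)\<close>, the right side is at least
    \<open>s (s + r)/(s + r + 1) = s - s/(s + r + 1)\<close>, and the last fraction is at most
    1.\<close>
  also have "\<dots> \<le> real q * (s * (s * (D + 1 / (s + r + 1))))"
  proof (rule mult_left_mono)
    have D: "real r / (s + r) \<le> D"
      using harm_add_diff_ge[of r "card S"] by (simp add: s_def D_def)
    have "real r / (s + r + 1) \<le> real r / (s + r)"
      using s by (intro divide_left_mono) auto
    moreover have "real r / (s + r + 1) = 1 - (s + 1) / (s + r + 1)"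
      using s by (simp add: field_simps)
    ultimately have "s * (1 - (s + 1) / (s + r + 1)) \<le> s * D"
      using D s by (intro mult_left_mono) auto
    moreover have "s / (s + r + 1) \<le> 1" using s by simp
    moreover have "s * (1 - (s + 1) / (s + r + 1)) + s * (s / (s + r + 1)) = s - s / (s + r + 1)"
      by (simp add: algebra_simps add_divide_distrib)
    ultimately have "s - 1 \<le> s * D + s * s / (s + r + 1)" by simp
    then show "(s - 1) * (s * D + 1) \<le> s * (s * (D + 1 / (s + r + 1)))"
      by (simp add: algebra_simps)
  qed simp
  also have "D + 1 / (s + r + 1) = harm (card S + Suc r) - harm (card S)"
    using harm_Suc[of "card S + r", where ?'a = real] by (simp add: D_def s_def divide_inverse add.commute)
  finally have "s * (\<Sum>i\<in>S - {j}. w i) \<le> s * (s * real q * (harm (card S + Suc r) - harm (card S)))"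
    by (simp add: mult_ac)
  with s show ?thesis by (simp add: s_def)
qed

lemma weight_reset:
  assumes "disjoint_family_on A {1..m}" "i \<in> {1..m}" "j \<in> {1..m}"
  shows "weight A (reset A j C) i = (if i = j then 0 else weight A C i)"
proof (cases "i = j")
  case False
  then have "A i \<inter> A j = {}" using assms by (auto simp: disjoint_family_on_def)
  then have "A i \<inter> (C - A j) = A i \<inter> C" by auto
  with False show ?thesis by (simp add: weight_def reset_def)
next
  case True
  have "A i \<inter> (C - A i) = {}" by auto
  with True show ?thesis by (simp add: weight_def reset_def)
qed

text \<open>By disjointness an element of \<open>X\<close> lies in at most one box of
  \<open>S\<close>. This serves both for full moves and for the partial moves inside a
  round.\<close>

lemma sum_weight_Un_le:
  assumes "disjoint_family_on A {1..m}" "S \<subseteq> {1..m}" "finite X"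
  shows "(\<Sum>i\<in>S. weight A (C \<union> X) i) \<le> (\<Sum>i\<in>S. weight A C i) + card X"
proof -
  have "finite S" using assms(2) finite_subset by blast
  have "(\<Sum>i\<in>S. weight A (C \<union> X) i) \<le> (\<Sum>i\<in>S. weight A C i + card (A i \<inter> X))"
    unfolding weight_def by (intro sum_mono) (simp add: Int_Un_distrib card_Un_le)
  also have "\<dots> = (\<Sum>i\<in>S. weight A C i) + card (\<Union>i\<in>S. A i \<inter> X)"
  proof -
    have "\<forall>i\<in>S. \<forall>j\<in>S. i \<noteq> j \<longrightarrow> (A i \<inter> X) \<inter> (A j \<inter> X) = {}"
      using assms(1,2) unfolding disjoint_family_on_def by blast
    then show ?thesis
      using \<open>finite S\<close> assms(3) by (simp add: sum.distrib card_UN_disjoint del: UN_simps)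
  qed
  also have "card (\<Union>i\<in>S. A i \<inter> X) \<le> card X"
    using assms(3) by (intro card_mono) auto
  finally show ?thesis by simp
qed

definition heaviest :: "(nat \<Rightarrow> 'a set) \<Rightarrow> nat \<Rightarrow> 'a set \<Rightarrow> nat" where
  "heaviest A m C = (SOME i. i \<in> {1..m} \<and> (\<forall>j\<in>{1..m}. weight A C j \<le> weight A C i))"

lemma heaviest:
  assumes "m \<ge> 1"
  shows "heaviest A m C \<in> {1..m}"
    and "j \<in> {1..m} \<Longrightarrow> weight A C j \<le> weight A C (heaviest A m C)"
proof -
  have "\<exists>i. i \<in> {1..m} \<and> (\<forall>j\<in>{1..m}. weight A C j \<le> weight A C i)"
    using obtains_MAX[of "{1..m}" "weight A C"] assms
    by (metis Max_ge atLeastAtMost_iff empty_iff finite_atLeastAtMost finite_imageI imageI order_refl)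
  note someI_ex[OF this, folded heaviest_def]
  then show "heaviest A m C \<in> {1..m}"
    and "j \<in> {1..m} \<Longrightarrow> weight A C j \<le> weight A C (heaviest A m C)" by auto
qed

text \<open>A strategy sees only the moves of BoxMaker, so the position is recovered by replaying
  them against heaviest-box resets.\<close>

definition greedy_position :: "(nat \<Rightarrow> 'a set) \<Rightarrow> nat \<Rightarrow> 'a set list \<Rightarrow> 'a set" where
  "greedy_position A m h = foldl (\<lambda>C X. reset A (heaviest A m (C \<union> X)) (C \<union> X)) {} h"

text \<open>\<open>butlast h\<close> holds the completed rounds and \<open>last h\<close> the
  current move. For empty \<open>h\<close> the value of \<open>last h\<close> is unspecified, but
  for \<open>m >= 1\<close> the chosen index is still valid.\<close>

definition greedy :: "(nat \<Rightarrow> 'a set) \<Rightarrow> nat \<Rightarrow> 'a strategy" where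
  "greedy A m h = heaviest A m (greedy_position A m (butlast h) \<union> last h)"

lemma play_greedy_position: "play A m q (greedy A m) h C \<Longrightarrow> C = greedy_position A m h"
  by (induction rule: play.induct) (auto simp: greedy_position_def greedy_def)

text \<open>The induction treats all \<open>S\<close> at once: when the reset box lies outside
  \<open>S\<close>, the bound for \<open>card S\<close> boxes comes from the bound for one more box,
  one round earlier.\<close>

lemma greedy_sum_weight_le:
  assumes "disjoint_family_on A {1..m}" "m \<ge> 1" "play A m q (greedy A m) h C" "S \<subseteq> {1..m}"
  shows "(\<Sum>i\<in>S. real (weight A C i)) \<le> real (card S) * real q * (harm (card S + length h) - harm (card S))"
  using assms(3,4)
proof (induction arbitrary: S rule: play.induct)
  case start
  then show ?case by (simp add: weight_def)
next
  case (round h C X)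
  define j where "j = heaviest A m (C \<union> X)"
  let ?w = "\<lambda>i. real (weight A (C \<union> X) i)"
  have greedy: "greedy A m (h @ [X]) = j"
    using play_greedy_position[OF round.hyps(1)] by (simp add: greedy_def j_def)
  have j: "j \<in> {1..m}" and max: "\<And>i. i \<in> {1..m} \<Longrightarrow> ?w i \<le> ?w j"
    using heaviest[OF assms(2), where A = A and C = "C \<union> X"] by (auto simp: j_def)
  have X: "finite X" "card X = q" using round.hyps(2) by (auto simp: maker_move_def)
  have fin: "finite S" using round.prems finite_subset by blast
  have bound: "(\<Sum>i\<in>T. ?w i) \<le> real (card T) * real q * (harm (card T + length h) - harm (card T)) + real q"
    if "T \<subseteq> {1..m}" for T
  proof -
    have "(\<Sum>i\<in>T. ?w i) \<le> (\<Sum>i\<in>T. real (weight A C i)) + real q"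
      using sum_weight_Un_le[OF assms(1) that X(1), of C] X(2)
      by (simp flip: of_nat_sum of_nat_add)
    with round.IH[OF that] show ?thesis by simp
  qed
  have "(\<Sum>i\<in>S. real (weight A (reset A j (C \<union> X)) i)) = (\<Sum>i\<in>S. if i = j then 0 else ?w i)"
    using round.prems weight_reset[OF assms(1) _ j] by (intro sum.cong) auto
  \<comment> \<open>The reset box contributes 0, so only weights from before the reset
    remain.\<close>
  also have "\<dots> = (\<Sum>i\<in>S - {j}. ?w i)"
    using fin by (intro sum.mono_neutral_cong_right) auto
  also have "\<dots> \<le> real (card S) * real q * (harm (card S + Suc (length h)) - harm (card S))"
  proof (cases "j \<in> S")
    case True
    show ?thesis
      by (rule sum_le_after_reset_inside[OF fin True _ bound]) (use max round.prems in auto)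
  next
    case False
    have "\<forall>i\<in>S. ?w i \<le> ?w j" using max round.prems by blast
    moreover have "insert j S \<subseteq> {1..m}" using j round.prems by simp
    note bound[OF this, unfolded card_insert_disjoint[OF fin False]]
    ultimately have "(\<Sum>i\<in>S. ?w i) \<le> real (card S) * real q * (harm (card S + Suc (length h)) - harm (card S))"
      by (rule sum_le_after_reset_outside[OF fin False])
    with False show ?thesis by simp
  qed
  finally show ?case using greedy by simp
qed

lemma greedy_weight_le:
  assumes "disjoint_family_on A {1..m}" "m \<ge> 1" "play A m q (greedy A m) h C" "i \<in> {1..m}"
  shows "real (weight A C i) \<le> real q * (harm (Suc (length h)) - 1)"
  using greedy_sum_weight_le[OF assms(1-3), of "{i}"] assms(4) by (simp add: harm_def)

theorem theorem2p6:
  fixes A :: "nat \<Rightarrow> 'a set" and m q k :: nat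
  assumes "m \<ge> 1" and "q \<ge> 1" and "k \<ge> 1"
    and "disjoint_family_on A {1..m}"
  shows "\<exists>\<sigma>. breaker_strategy m \<sigma> \<and>
           (\<forall>C. position_within A m q \<sigma> k C \<longrightarrow>
             (\<forall>i\<in>{1..m}. real (weight A C i) \<le> real q * (1 + ln (real m + real k))))"
proof (intro exI conjI allI impI ballI)
  show "breaker_strategy m (greedy A m)"
    unfolding breaker_strategy_def greedy_def by (intro allI heaviest(1) assms(1))
next
  fix C i
  assume "position_within A m q (greedy A m) k C" and i: "i \<in> {1..m}"
  then show "real (weight A C i) \<le> real q * (1 + ln (real m + real k))"
  proof (induction rule: position_within.induct)
    case (between_rounds h C)
    have "real (weight A C i) \<le> real q * (harm (Suc (length h)) - 1)"
      using greedy_weight_le[OF assms(4,1) between_rounds(1) i] .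
    also have "\<dots> \<le> real q * ln (real (Suc (length h)))"
      using harm_Suc_le_one_plus_ln[of "length h"] by (intro mult_left_mono) auto
    also have "\<dots> \<le> real q * (1 + ln (real m + real k))"
    proof (rule mult_left_mono)
      \<comment> \<open>Here \<open>length h\<close> may equal \<open>k\<close>, so
        \<open>m >= 1\<close> accounts for the successor.\<close>
      have "ln (real (Suc (length h))) \<le> ln (real m + real k)"
        using between_rounds(2) assms(1) by (subst ln_le_cancel_iff) auto
      then show "ln (real (Suc (length h))) \<le> 1 + ln (real m + real k)" by simp
    qed simp
    finally show ?case .
  next
    case (within_round h C P)
    have "weight A (C \<union> P) i \<le> weight A C i + q"
      using sum_weight_Un_le[OF assms(4) _ within_round(4), of "{i}" C] i within_round(5) by simp
    then have "real (weight A (C \<union> P) i) \<le> real (weight A C i) + real q" by linarith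
    \<comment> \<open>The at most \<open>q\<close> elements claimed in the current round make up for
      the \<open>- 1\<close>, that is \<open>H(1)\<close>, in the bound between rounds.\<close>
    also have "\<dots> \<le> real q * harm (Suc (length h))"
      using greedy_weight_le[OF assms(4,1) within_round(1) i] by (simp add: algebra_simps)
    also have "\<dots> \<le> real q * (1 + ln (real (Suc (length h))))"
      using harm_Suc_le_one_plus_ln[of "length h"] by (intro mult_left_mono) auto
    also have "\<dots> \<le> real q * (1 + ln (real m + real k))"
    proof (rule mult_left_mono)
      show "1 + ln (real (Suc (length h))) \<le> 1 + ln (real m + real k)"
        using within_round(2) assms(1) by (auto intro!: ln_mono)
    qed simp
    finally show ?case .
  qed
qed

end
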